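(* Let $\{K_i\}_{i=1}^\infty$ be Cantor sets in $\mathbb{R}$ such that $K_i$ and $K_j$ have different convex hulls whenever $i\neq j$. If $$\inf_{i\ge1}\tau(K_i)>0\quad\text{and}\quad\inf_{i\ge1}\min(K_i)>0,$$ then there exist $k\in\mathbb{N}$ and $k$ different Cantor sets $K_{i_1},\dots,K_{i_k}$ among the $K_i$ such that $$\prod_{j=1}^kK_{i_j}=\Big\{\prod_{j=1}^kx_{i_j}:x_{i_j}\in K_{i_j}\Big\}$$ is a finite union of closed intervals.
   Context: Thickness. Let $K\subset\mathbb{R}$ be a Cantor set with convex hull $I$. The gaps of $K$ are the bounded connected components of $\mathbb{R}\setminus K$; they are enumerated as $(O_n)_{n\ge1}$ with non-increasing lengths $|O_n|$ (ties ordered arbitrarily). For each $n$, let $I_n$ be the connected component of $I\setminus(O_1\cup\cdots\cup O_{n-1})$ containing $O_n$, and let $L_n,R_n$ be the left and right closed intervals of $I_n\setminus O_n$ (called bridges). Then $$\tau(K)=\inf_{n}\frac{\min\{|L_n|,|R_n|\}}{|O_n|}.$$ It is always assumed that there are infinitely many gaps and that $K$ has no isolated points. $\min(K)$ denotes the smallest element of $K$; the product in the conclusion is the set of pointwise products of real numbers. *)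

theory Defs
  imports "HOL-Analysis.Analysis"
begin

definition cantor_set :: "real set \<Rightarrow> bool" where
  "cantor_set K \<longleftrightarrow>
     K \<noteq> {} \<and> compact K \<and> (\<forall>x\<in>K. \<not> x isolated_in K) \<and> (\<forall>C\<in>components K. \<exists>x. C = {x})"

definition gaps :: "real set \<Rightarrow> real set set" where
  "gaps K = {U \<in> components (- K). bounded U}"

definition gap_enumeration :: "real set \<Rightarrow> (nat \<Rightarrow> real set) \<Rightarrow> bool" where
  "gap_enumeration K G \<longleftrightarrow>
     bij_betw G UNIV (gaps K) \<and> decseq (\<lambda>n. measure lborel (G n))"

definition gap_parent :: "real set \<Rightarrow> (nat \<Rightarrow> real set) \<Rightarrow> nat \<Rightarrow> real set" where
  "gap_parent K G n = (THE C. C \<in> components (convex hull K - (\<Union>m<n. G m)) \<and> G n \<subseteq> C)"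

definition left_bridge :: "real set \<Rightarrow> (nat \<Rightarrow> real set) \<Rightarrow> nat \<Rightarrow> real set" where
  "left_bridge K G n = {x \<in> gap_parent K G n. \<forall>y\<in>G n. x < y}"

definition right_bridge :: "real set \<Rightarrow> (nat \<Rightarrow> real set) \<Rightarrow> nat \<Rightarrow> real set" where
  "right_bridge K G n = {x \<in> gap_parent K G n. \<forall>y\<in>G n. y < x}"

definition thickness_along :: "real set \<Rightarrow> (nat \<Rightarrow> real set) \<Rightarrow> real" where
  "thickness_along K G =
     (INF n. min (measure lborel (left_bridge K G n)) (measure lborel (right_bridge K G n))
               / measure lborel (G n))"

text \<open>\<open>SOME\<close> picks an arbitrary order among gaps of equal length; that a Cantor set
  has a gap enumeration at all is \<open>gap_enumeration_exists\<close> below.\<close>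

definition thickness :: "real set \<Rightarrow> real" where
  "thickness K = thickness_along K (SOME G. gap_enumeration K G)"

text \<open>Closed intervals are taken compact and non-degenerate.\<close>

definition finite_union_closed_intervals :: "real set \<Rightarrow> bool" where
  "finite_union_closed_intervals S \<longleftrightarrow>
     (\<exists>F. finite F \<and> (\<forall>J\<in>F. \<exists>a b. a < b \<and> J = {a..b}) \<and> S = \<Union>F)"

lemma infinite_decreasing_enumeration:
  fixes f :: "'a \<Rightarrow> real"
  assumes inf: "infinite S" and pos: "\<And>s. s \<in> S \<Longrightarrow> f s > 0"
    and fin: "\<And>e. e > 0 \<Longrightarrow> finite {s \<in> S. f s \<ge> e}"
  shows "\<exists>g::nat \<Rightarrow> 'a. bij_betw g UNIV S \<and> decseq (\<lambda>n. f (g n))"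
proof -
  have "\<exists>g::nat \<Rightarrow> 'a. \<forall>n. g n \<in> S - g ` {..<n} \<and> (\<forall>t \<in> S - g ` {..<n}. f t \<le> f (g n))"
  proof (rule dependent_wellorder_choice)
    fix r :: 'a and g h :: "nat \<Rightarrow> 'a" and n :: nat
    assume "\<And>m. m < n \<Longrightarrow> g m = h m"
    then have "g ` {..<n} = h ` {..<n}" by auto
    then show "(r \<in> S - g ` {..<n} \<and> (\<forall>t \<in> S - g ` {..<n}. f t \<le> f r)) =
               (r \<in> S - h ` {..<n} \<and> (\<forall>t \<in> S - h ` {..<n}. f t \<le> f r))" by simp
  next
    fix n :: nat and g :: "nat \<Rightarrow> 'a"
    let ?A = "S - g ` {..<n}"
    have "infinite ?A" using inf by (simp add: Diff_infinite_finite)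
    then have "?A \<noteq> {}" by (metis finite.emptyI)
    then obtain a where a: "a \<in> ?A" by blast
    let ?B = "{s \<in> ?A. f s \<ge> f a}"
    have "finite ?B"
      by (rule finite_subset[OF _ fin[of "f a"]]) (use a pos in auto)
    moreover have "a \<in> ?B" using a by auto
    ultimately have B: "finite (f ` ?B)" "f ` ?B \<noteq> {}" by blast+
    then obtain r where "r \<in> ?B" "f r = Max (f ` ?B)" using Max_in[OF B] by fastforce
    then have r: "r \<in> ?B" "\<And>t. t \<in> ?B \<Longrightarrow> f t \<le> f r" using Max_ge[OF B(1)] by auto
    have "f t \<le> f r" if "t \<in> ?A" for t
    proof (cases "f t \<ge> f a")
      case True then show ?thesis using r(2) that by auto
    next
      case False then show ?thesis using r(1) by auto
    qed
    then show "\<exists>r. r \<in> ?A \<and> (\<forall>t \<in> ?A. f t \<le> f r)" using r(1) by blast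
  qed
  then obtain g :: "nat \<Rightarrow> 'a" where g: "\<And>n. g n \<in> S - g ` {..<n}"
    and mx: "\<And>n t. t \<in> S - g ` {..<n} \<Longrightarrow> f t \<le> f (g n)" by blast
  have "g m \<noteq> g n" if "m < n" for m n using g[of n] that by (metis DiffE imageI lessThan_iff)
  then have inj: "inj g" by (metis injI linorder_neqE_nat)
  have "f (g n) \<le> f (g m)" if "m \<le> n" for m n
    by (rule mx) (use g[of n] that in auto)
  then have dec: "decseq (\<lambda>n. f (g n))" by (simp add: decseq_def)
  have "s \<in> range g" if "s \<in> S" for s
  proof (rule ccontr)
    assume "s \<notin> range g"
    then have "f s \<le> f (g n)" for n using mx[of s n] that by auto
    then have "range g \<subseteq> {t \<in> S. f t \<ge> f s}" using g by auto
    then have "finite (range g)" using fin[of "f s"] pos[OF that] finite_subset by blast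
    then show False using inj finite_imageD by blast
  qed
  then have "range g = S" using g by auto
  then show ?thesis using inj dec by (auto simp: bij_betw_def)
qed

lemma gap_between:
  assumes "cantor_set K" "x \<in> K" "y \<in> K" "x < y"
  shows "\<exists>U \<in> gaps K. U \<subseteq> {x<..<y}"
proof -
  have "\<not> {x..y} \<subseteq> K"
  proof
    assume "{x..y} \<subseteq> K"
    then have "{x..y} \<subseteq> connected_component_set K x"
      using assms by (intro connected_component_maximal) auto
    moreover have "connected_component_set K x \<in> components K"
      using assms by (simp add: componentsI)
    then obtain z where "connected_component_set K x = {z}"
      using assms(1) by (auto simp: cantor_set_def)
    ultimately have "{x..y} \<subseteq> {z}" by simp
    moreover have "x \<in> {x..y}" "y \<in> {x..y}" using assms(4) by auto
    ultimately show False using assms(4) by blast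
  qed
  then obtain z where z: "z \<in> {x..y}" "z \<notin> K" by blast
  let ?U = "connected_component_set (- K) z"
  have U: "?U \<in> components (- K)" using z by (simp add: componentsI)
  have zU: "z \<in> ?U" using z by simp
  have sub: "?U \<subseteq> - K" by (rule connected_component_subset)
  have iv: "is_interval ?U" by (simp add: is_interval_connected_1)
  have "w \<in> {x<..<y}" if w: "w \<in> ?U" for w
  proof (rule ccontr)
    assume "w \<notin> {x<..<y}"
    then have "w \<le> x \<or> y \<le> w" by auto
    then have "x \<in> ?U \<or> y \<in> ?U"
      using mem_is_interval_1_I[OF iv w zU] mem_is_interval_1_I[OF iv zU w] z by auto
    then show False using sub assms by auto
  qed
  then have "?U \<subseteq> {x<..<y}" by blast
  moreover from this have "bounded ?U"
    using bounded_subset[OF bounded_Ioo] by blast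
  ultimately show ?thesis using U by (auto simp: gaps_def)
qed

lemma infinite_gaps:
  assumes "cantor_set K"
  shows "infinite (gaps K)"
proof
  assume fin: "finite (gaps K)"
  let ?h = "\<lambda>x. {U \<in> gaps K. U \<subseteq> {..<x}}"
  have ne: "?h x \<noteq> ?h y" if xy: "x \<in> K" "y \<in> K" "x < y" for x y
  proof -
    obtain U where U: "U \<in> gaps K" "U \<subseteq> {x<..<y}" using gap_between[OF assms xy] by blast
    moreover have "U \<noteq> {}" using U(1) in_components_nonempty by (auto simp: gaps_def)
    ultimately have "U \<in> ?h y" "U \<notin> ?h x" by fastforce+
    then show ?thesis by blast
  qed
  have "inj_on ?h K"
  proof (rule inj_onI)
    fix x y assume "x \<in> K" "y \<in> K" "?h x = ?h y"
    then show "x = y" using ne[of x y] ne[of y x] by (metis linorder_neqE)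
  qed
  moreover have "finite (?h ` K)" by (rule finite_subset[of _ "Pow (gaps K)"]) (use fin in auto)
  ultimately have "finite K" using finite_imageD by blast
  moreover obtain x where "x \<in> K" "x islimpt K"
    using assms by (auto simp: cantor_set_def isolated_in_islimpt_iff)
  ultimately show False using islimpt_finite by blast
qed

lemma gap_props:
  assumes "cantor_set K" "U \<in> gaps K"
  shows "open U" "U \<noteq> {}" "bounded U" "connected U" "U \<inter> K = {}" "U \<subseteq> convex hull K"
proof -
  have cl: "open (- K)" using assms by (simp add: cantor_set_def compact_imp_closed open_Compl)
  have U: "U \<in> components (- K)" "bounded U" using assms by (auto simp: gaps_def)
  show "open U" using U(1) cl open_components by blast
  show ne: "U \<noteq> {}" using U in_components_nonempty by blast
  show "bounded U" by fact
  show "connected U" using U in_components_connected by blast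
  show dj: "U \<inter> K = {}" using U in_components_subset by blast
  have cn: "connected (convex hull K)" by (simp add: convex_connected)
  show "U \<subseteq> convex hull K"
  proof
    fix u assume u: "u \<in> U"
    have iv: "is_interval (convex hull K)" by (simp add: is_interval_convex_1)
    have max: "T \<subseteq> U" if "connected T" "T \<subseteq> - K" "u \<in> T" for T
      using components_maximal[OF U(1) that(1,2)] that(3) u by blast
    have "\<exists>k\<in>K. k \<le> u"
    proof (rule ccontr)
      assume "\<not> ?thesis"
      then have "{..u} \<subseteq> U" by (intro max) auto
      then have "bdd_below {..u}" by (intro bounded_imp_bdd_below bounded_subset[OF U(2)])
      then obtain m where "\<And>x. x \<le> u \<Longrightarrow> m \<le> x" by (auto simp: bdd_below_def)
      from this[of "min m u - 1"] show False by linarith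
    qed
    then obtain k where k: "k \<in> K" "k \<le> u" by blast
    have "\<exists>k\<in>K. u \<le> k"
    proof (rule ccontr)
      assume "\<not> ?thesis"
      then have "{u..} \<subseteq> U" by (intro max) auto
      then have "bdd_above {u..}" by (intro bounded_imp_bdd_above bounded_subset[OF U(2)])
      then obtain m where "\<And>x. u \<le> x \<Longrightarrow> x \<le> m" by (auto simp: bdd_above_def)
      from this[of "max m u + 1"] show False by linarith
    qed
    then obtain l where l: "l \<in> K" "u \<le> l" by blast
    show "u \<in> convex hull K"
      using mem_is_interval_1_I[OF iv, of k l u] k l hull_inc[of _ K convex] by blast
  qed
qed

lemma gap_enumeration_exists:
  assumes "cantor_set K"
  shows "\<exists>G. gap_enumeration K G"
  unfolding gap_enumeration_def
proof (rule infinite_decreasing_enumeration)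
  let ?H = "convex hull K"
  have "compact ?H" using assms by (simp add: cantor_set_def compact_convex_hull)
  then have H: "?H \<in> lmeasurable" by (rule lmeasurable_compact)
  show "infinite (gaps K)" using assms by (rule infinite_gaps)
  fix U assume U: "U \<in> gaps K"
  note gp = gap_props[OF assms U]
  show "measure lborel U > 0"
  proof -
    obtain x e where "e > 0" "ball x e \<subseteq> U" using gp(1,2) by (meson ex_in_conv open_contains_ball)
    have lU: "U \<in> lmeasurable" using gp(3,1) by (rule lmeasurable_open)
    have "measure lebesgue (ball x e) \<le> measure lebesgue U"
      by (rule measure_mono_fmeasurable) (simp_all add: lU \<open>ball x e \<subseteq> U\<close>)
    moreover have "measure lebesgue (ball x e) > 0" using \<open>e > 0\<close> by (simp add: content_ball_pos)
    moreover have "measure lebesgue U = measure lborel U"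
      using gp(1) by (intro measure_completion) simp
    ultimately show ?thesis by linarith
  qed
next
  let ?H = "convex hull K"
  have "compact ?H" using assms by (simp add: cantor_set_def compact_convex_hull)
  then have H: "?H \<in> lmeasurable" by (rule lmeasurable_compact)
  fix e :: real assume e: "e > 0"
  show "finite {U \<in> gaps K. measure lborel U \<ge> e}" (is "finite ?S")
  proof (rule finite_if_finite_subsets_card_bdd[THEN conjunct1])
    fix F assume F: "F \<subseteq> ?S" "finite F"
    have gp: "open U" "bounded U" "U \<subseteq> ?H" if "U \<in> F" for U
      using gap_props[OF assms, of U] F that by auto
    have lm: "U \<in> lmeasurable" if "U \<in> F" for U using gp[OF that] by (simp add: lmeasurable_open)
    have "pairwise disjnt F"
      by (rule pairwise_mono[OF pairwise_disjoint_components[of "- K"]])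
        (use F(1) in \<open>auto simp: gaps_def disjnt_def\<close>)
    then have "measure lebesgue (\<Union>F) = (\<Sum>U\<in>F. measure lebesgue U)"
      using F(2) lm by (intro measure_Union') auto
    moreover have "measure lebesgue (\<Union>F) \<le> measure lebesgue ?H"
    proof (rule measure_mono_fmeasurable)
      show "\<Union>F \<subseteq> ?H" using gp(3) by blast
      show "\<Union>F \<in> sets lebesgue" using F(2) lm by (intro sets.finite_Union) auto
    qed (rule H)
    moreover have "card F * e \<le> (\<Sum>U\<in>F. measure lebesgue U)"
    proof (rule sum_bounded_below)
      fix U assume that: "U \<in> F"
      have "measure lebesgue U = measure lborel U"
        using gp(1)[OF that] by (intro measure_completion) simp
      then show "e \<le> measure lebesgue U" using F(1) that by auto
    qed
    ultimately have "card F \<le> measure lebesgue ?H / e" using e by (simp add: field_simps)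
    then show "card F \<le> nat \<lceil>measure lebesgue ?H / e\<rceil>" by linarith
  qed
qed

end

theory Submission
  imports Defs
begin

text \<open>Logarithms turn products into sums, so it suffices to show that a sum of sufficiently many
  compact sets, each of thickness at least a fixed \<open>\<tau> > 0\<close> and with more than one point, is a
  finite union of intervals; \<open>1 + 1 / \<tau>\<close> sets are enough (\<open>sumset_of_thick_sets\<close>). Different
  convex hulls make the sets different, so any sufficiently long initial segment of the
  sequence will do.

  Thickness is used in a form that mentions no enumeration of the gaps (\<open>thick\<close>): a gap keeps
  distance at least \<open>\<tau>\<close> times its length from both ends of the set, and two gaps keep distance at
  least \<open>\<tau>\<close> times the smaller of their lengths. The logarithm preserves this with a worse constant
  (\<open>thick_ln\<close>). On a positive set a gap \<open>(u, v)\<close> satisfies \<open>\<tau> (v - u) \<le> u\<close>, because its left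
  bridge does not reach \<open>0\<close>; hence \<open>v / u\<close> is bounded, and \<open>ln\<close> has bounded distortion across a gap.

  For the sum, let \<open>[p\<^sub>i, q\<^sub>i]\<close> be a piece of the \<open>i\<close>-th set, and let \<open>(u, v)\<close> be the largest of all
  gaps inside these pieces, lying in the \<open>i\<close>-th, say. If the pieces are all at least \<open>\<tau> (v - u)\<close>
  long and there are at least \<open>1 + 1 / \<tau>\<close> of them, the pieces other than the \<open>i\<close>-th have total length
  at least \<open>v - u\<close>. So replacing \<open>[p\<^sub>i, q\<^sub>i]\<close> by either \<open>[p\<^sub>i, u]\<close> or \<open>[v, q\<^sub>i]\<close> loses no point of the sum
  of the intervals: the two new sums overlap. By thickness both halves have length at least \<open>\<tau> (v - u)\<close>, so
  the situation reproduces itself, and repeating the step catches every point of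
  \<open>[\<Sum> p\<^sub>i, \<Sum> q\<^sub>i]\<close> in pieces with arbitrarily small gaps (\<open>sumset_of_comparable_bridges\<close>).

  The sets of the theorem may have very different sizes. With \<open>\<delta>\<close> the length of the shortest
  hull, the same splitting, stopped once all gaps are shorter than \<open>\<delta>\<close>, produces finitely
  many tuples of pieces of length at least \<open>\<tau> \<delta>\<close>. Each tuple then sums to an
  interval (\<open>sumset_of_bridges\<close>).\<close>

section \<open>Thickness through pairs of gaps\<close>

definition gap_ends :: "real set \<Rightarrow> real \<Rightarrow> real \<Rightarrow> bool" where
  "gap_ends A u v \<longleftrightarrow> u \<in> A \<and> v \<in> A \<and> u < v \<and> {u<..<v} \<inter> A = {}"

text \<open>The ends of \<open>A\<close> enter only through points of \<open>A\<close> far enough to the left and to the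
  right of the gap. The minimum in the last condition makes it symmetric in the two gaps, which
  dispenses with any ordering of gaps of equal length.\<close>

definition thick :: "real \<Rightarrow> real set \<Rightarrow> bool" where
  "thick \<tau> A \<longleftrightarrow>
     (\<forall>u v. gap_ends A u v \<longrightarrow>
        (\<exists>a\<in>A. \<tau> * (v - u) \<le> u - a) \<and> (\<exists>b\<in>A. \<tau> * (v - u) \<le> b - v)) \<and>
     (\<forall>u v u' v'. gap_ends A u v \<longrightarrow> gap_ends A u' v' \<longrightarrow> v \<le> u' \<longrightarrow>
        \<tau> * min (v - u) (v' - u') \<le> u' - v)"

lemma gap_ends_unique: "gap_ends A u v \<Longrightarrow> gap_ends A u v' \<Longrightarrow> v = v'"
  unfolding gap_ends_def by (metis disjoint_iff greaterThanLessThan_iff linorder_neqE)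

lemma gap_ends_ordered: "gap_ends A u v \<Longrightarrow> gap_ends A u' v' \<Longrightarrow> u < u' \<Longrightarrow> v \<le> u'"
  unfolding gap_ends_def by (meson disjoint_iff greaterThanLessThan_iff not_le)

text \<open>The left ends of gaps of length at least \<open>e\<close> are \<open>e\<close>-separated, hence told apart by
  \<open>\<lfloor>u / e\<rfloor>\<close>, which takes finitely many values on a bounded set.\<close>

lemma finite_large_gaps:
  assumes A: "compact A" and e: "e > 0"
  shows "finite {(u, v). gap_ends A u v \<and> e \<le> v - u}" (is "finite ?S")
proof -
  obtain B where B: "\<And>x. x \<in> A \<Longrightarrow> \<bar>x\<bar> \<le> B"
    using compact_imp_bounded[OF A] unfolding bounded_iff by auto
  have inj: "inj_on (\<lambda>(u, v). \<lfloor>u / e\<rfloor>) ?S"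
  proof (rule inj_onI, clarify)
    fix u v u' v'
    assume g: "gap_ends A u v" "gap_ends A u' v'" "e \<le> v - u" "e \<le> v' - u'"
      and eq: "\<lfloor>u / e\<rfloor> = \<lfloor>u' / e\<rfloor>"
    have close: "\<bar>u / e - u' / e\<bar> < 1" using eq by linarith
    then have "\<bar>u - u'\<bar> < e" using e by (simp add: field_simps abs_if split: if_splits)
    then have "u = u'"
      using gap_ends_ordered[OF g(1,2)] gap_ends_ordered[OF g(2,1)] g(3,4) by linarith
    then show "u = u' \<and> v = v'" using gap_ends_unique g by blast
  qed
  have "(\<lambda>(u, v). \<lfloor>u / e\<rfloor>) ` ?S \<subseteq> {\<lfloor>- B / e\<rfloor>..\<lfloor>B / e\<rfloor>}"
  proof clarify
    fix u v assume "gap_ends A u v"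
    then have "\<bar>u\<bar> \<le> B" using B by (auto simp: gap_ends_def)
    then have "- B / e \<le> u / e" "u / e \<le> B / e" using e by (intro divide_right_mono; linarith)+
    then show "\<lfloor>u / e\<rfloor> \<in> {\<lfloor>- B / e\<rfloor>..\<lfloor>B / e\<rfloor>}" by (simp add: floor_mono)
  qed
  then show ?thesis using inj finite_imageD finite_subset by blast
qed

lemma gap_ends_around:
  assumes A: "compact A" and pq: "p \<in> A" "q \<in> A" "p \<le> x" "x \<le> q" and x: "x \<notin> A"
  obtains u v where "gap_ends A u v" "p \<le> u" "u < x" "x < v" "v \<le> q"
proof -
  have "compact (A \<inter> {p..x})" "A \<inter> {p..x} \<noteq> {}" using A pq by (auto simp: compact_Int)
  then obtain u where u: "u \<in> A \<inter> {p..x}" "\<And>y. y \<in> A \<inter> {p..x} \<Longrightarrow> y \<le> u"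
    using compact_attains_sup by meson
  have "compact (A \<inter> {x..q})" "A \<inter> {x..q} \<noteq> {}" using A pq by (auto simp: compact_Int)
  then obtain v where v: "v \<in> A \<inter> {x..q}" "\<And>y. y \<in> A \<inter> {x..q} \<Longrightarrow> v \<le> y"
    using compact_attains_inf by meson
  have "y \<notin> A" if "u < y" "y < v" for y
    using u(1) v(1) u(2)[of y] v(2)[of y] that by (cases "y \<le> x") auto
  then have "{u<..<v} \<inter> A = {}" by auto
  moreover have "u \<noteq> x" "v \<noteq> x" using u v x by auto
  ultimately show ?thesis using that[of u v] u(1) v(1) by (simp add: gap_ends_def)
qed

lemma gap_ends_in_gaps:
  assumes "gap_ends K u v"
  shows "{u<..<v} \<in> gaps K"
proof -
  from assms have uv: "u \<in> K" "v \<in> K" "u < v" "{u<..<v} \<subseteq> - K" by (auto simp: gap_ends_def)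
  have "C = {u<..<v}" if C: "connected C" "{u<..<v} \<subseteq> C" "C \<subseteq> - K" for C
  proof -
    have iv: "is_interval C" using C by (simp add: is_interval_connected_1)
    obtain z where z: "z \<in> C" "u < z" "z < v" using C(2) dense[OF uv(3)] by auto
    have "u \<notin> C" "v \<notin> C" using C uv by auto
    then have "w \<in> {u<..<v}" if "w \<in> C" for w
      using mem_is_interval_1_I[OF iv that z(1), of u] mem_is_interval_1_I[OF iv z(1) that, of v] z
      by force
    then show ?thesis using C(2) by blast
  qed
  moreover have "- K \<noteq> {}" "{u<..<v} \<noteq> {}" using uv by auto
  ultimately have "{u<..<v} \<in> components (- K)"
    using exists_component_superset[of "{u<..<v}" "- K"] uv(4)
    by (metis connected_Ioo in_components_connected in_components_subset)
  then show ?thesis by (simp add: gaps_def)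
qed

text \<open>Stated for arbitrary \<open>S\<close>, so that bridges can be measured without first being recognised as
  intervals.\<close>

lemma measure_le_length:
  fixes a b :: real
  assumes "S \<subseteq> {a..b}" "a \<le> b"
  shows "measure lborel S \<le> b - a"
proof -
  have "emeasure lborel S \<le> emeasure lborel {a..b}" by (rule emeasure_mono) (use assms in auto)
  also have "\<dots> = ennreal (b - a)" using assms by simp
  finally show ?thesis unfolding measure_def using assms by (simp add: enn2real_leI)
qed

text \<open>Justifies the definite description in \<open>gap_parent\<close>: the \<open>n\<close>-th gap is connected and disjoint
  from the earlier ones, so exactly one component contains it.\<close>

lemma gap_parent_properties:
  assumes K: "cantor_set K" and G: "gap_enumeration K G"
  shows "gap_parent K G n \<in> components (convex hull K - (\<Union>m<n. G m))" "G n \<subseteq> gap_parent K G n"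
proof -
  let ?S = "convex hull K - (\<Union>m<n. G m)"
  have inj: "inj G" using G by (simp add: gap_enumeration_def bij_betw_def)
  have Gg: "G m \<in> gaps K" for m using G by (auto simp: gap_enumeration_def bij_betw_def)
  note gp = gap_props[OF K Gg]
  have "G m \<inter> G n = {}" if "m < n" for m
  proof -
    have "G m \<noteq> G n" using inj that by (auto dest: injD)
    then show ?thesis using Gg[of m] Gg[of n] components_nonoverlap by (auto simp: gaps_def)
  qed
  then have sub: "G n \<subseteq> ?S" using gp(6)[of n] by blast
  have "\<exists>!C. C \<in> components ?S \<and> G n \<subseteq> C"
  proof (rule ex_ex1I)
    show "\<exists>C. C \<in> components ?S \<and> G n \<subseteq> C"
      using exists_component_superset[OF sub _ gp(4)] sub gp(2)[of n] by blast
    show "C = D" if "C \<in> components ?S \<and> G n \<subseteq> C" "D \<in> components ?S \<and> G n \<subseteq> D" for C D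
      using that gp(2)[of n] components_nonoverlap[of C ?S D] by blast
  qed
  from theI'[OF this] show "gap_parent K G n \<in> components ?S" "G n \<subseteq> gap_parent K G n"
    unfolding gap_parent_def by blast+
qed

text \<open>A bridge of the \<open>n\<close>-th gap cannot extend past a gap of smaller index, since the component
  containing it is an interval and avoids that gap.\<close>

lemma bridges_bounded:
  assumes K: "cantor_set K" and G: "gap_enumeration K G" and n: "G n = {u<..<v}" "u < v"
  shows "left_bridge K G n \<subseteq> {..u}" "right_bridge K G n \<subseteq> {v..}"
    and "left_bridge K G n \<subseteq> convex hull K" "right_bridge K G n \<subseteq> convex hull K"
    and "m < n \<Longrightarrow> G m = {u'<..<v'} \<Longrightarrow> u' < v' \<Longrightarrow> v' \<le> u \<Longrightarrow> left_bridge K G n \<subseteq> {v'..}"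
    and "m < n \<Longrightarrow> G m = {u'<..<v'} \<Longrightarrow> u' < v' \<Longrightarrow> v \<le> u' \<Longrightarrow> right_bridge K G n \<subseteq> {..u'}"
proof -
  let ?C = "gap_parent K G n"
  note C = gap_parent_properties[OF K G, of n]
  have iv: "is_interval ?C"
    using C(1) by (simp add: is_interval_connected_1 in_components_connected)
  have sub: "?C \<subseteq> convex hull K - (\<Union>m<n. G m)" using C(1) by (rule in_components_subset)
  show "left_bridge K G n \<subseteq> convex hull K" "right_bridge K G n \<subseteq> convex hull K"
    using sub by (auto simp: left_bridge_def right_bridge_def)
  show "left_bridge K G n \<subseteq> {..u}"
  proof
    fix x assume "x \<in> left_bridge K G n"
    then have "x < y" if "u < y" "y < v" for y using n that by (simp add: left_bridge_def)
    then show "x \<in> {..u}" using dense_ge_bounded[of u v x] n by (simp add: less_imp_le)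
  qed
  show "right_bridge K G n \<subseteq> {v..}"
  proof
    fix x assume "x \<in> right_bridge K G n"
    then have "y < x" if "u < y" "y < v" for y using n that by (simp add: right_bridge_def)
    then show "x \<in> {v..}" using dense_le_bounded[of u v x] n by (simp add: less_imp_le)
  qed
  obtain z where z: "z \<in> ?C" "u < z" "z < v" using C(2) n dense[of u v] by auto
  {
    assume m: "m < n" "G m = {u'<..<v'}" "u' < v'" "v' \<le> u"
    show "left_bridge K G n \<subseteq> {v'..}"
    proof
      fix x assume "x \<in> left_bridge K G n"
      then have x: "x \<in> ?C" by (simp add: left_bridge_def)
      show "x \<in> {v'..}"
      proof (rule ccontr)
        assume "x \<notin> {v'..}"
        then obtain w where w: "max x u' < w" "w < v'" using m(3) dense[of "max x u'" v'] by auto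
        then have "w \<in> ?C" using mem_is_interval_1_I[OF iv x z(1), of w] m z by simp
        moreover have "w \<in> G m" using m w by simp
        ultimately show False using sub m(1) by blast
      qed
    qed
  next
    assume m: "m < n" "G m = {u'<..<v'}" "u' < v'" "v \<le> u'"
    show "right_bridge K G n \<subseteq> {..u'}"
    proof
      fix x assume "x \<in> right_bridge K G n"
      then have x: "x \<in> ?C" by (simp add: right_bridge_def)
      show "x \<in> {..u'}"
      proof (rule ccontr)
        assume "x \<notin> {..u'}"
        then obtain w where w: "u' < w" "w < min x v'" using m(3) dense[of u' "min x v'"] by auto
        then have "w \<in> ?C" using mem_is_interval_1_I[OF iv z(1) x, of w] m z by simp
        moreover have "w \<in> G m" using m w by simp
        ultimately show False using sub m(1) by blast
      qed
    qed
  }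
qed

text \<open>Of two gaps, the one with the larger index is not the longer one, and its bridge towards the
  other fits between them; thickness bounds this bridge from below by \<open>\<tau>\<close> times the smaller
  length. The ends of the set are treated in the same way, with the convex hull in
  place of the earlier gap.\<close>

lemma thick_of_thickness:
  assumes K: "cantor_set K" and \<tau>: "\<tau> \<le> thickness K"
  shows "thick \<tau> K"
proof -
  define G where "G = (SOME G. gap_enumeration K G)"
  have G: "gap_enumeration K G"
    unfolding G_def using gap_enumeration_exists[OF K] by (rule someI_ex)
  let ?L = "\<lambda>n. measure lborel (left_bridge K G n)"
  let ?R = "\<lambda>n. measure lborel (right_bridge K G n)"
  let ?r = "\<lambda>n. min (?L n) (?R n) / measure lborel (G n)"
  have thickness: "thickness K = (INF n. ?r n)"
    by (simp add: thickness_def thickness_along_def G_def)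
  have bridges: "\<tau> * (v - u) \<le> ?L n" "\<tau> * (v - u) \<le> ?R n"
    if n: "G n = {u<..<v}" "u < v" for n u v
  proof -
    have "bdd_below (range ?r)" by (rule bdd_belowI[of _ 0]) auto
    then have "\<tau> \<le> ?r n" using \<tau> cINF_lower[of ?r UNIV n] thickness by simp
    then have "\<tau> * (v - u) \<le> min (?L n) (?R n)" using n by (simp add: pos_le_divide_eq)
    then show "\<tau> * (v - u) \<le> ?L n" "\<tau> * (v - u) \<le> ?R n" by auto
  qed
  have index: "\<exists>n. G n = {u<..<v}" if "gap_ends K u v" for u v
    using gap_ends_in_gaps[OF that] G unfolding gap_enumeration_def bij_betw_def by (metis rangeE)
  obtain a b where a: "a \<in> K" "\<And>x. x \<in> K \<Longrightarrow> a \<le> x" and b: "b \<in> K" "\<And>x. x \<in> K \<Longrightarrow> x \<le> b"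
    using K compact_attains_inf compact_attains_sup by (metis cantor_set_def)
  have hull: "convex hull K \<subseteq> {a..b}" by (rule hull_minimal) (use a b in auto)
  show ?thesis
    unfolding thick_def
  proof (intro conjI allI impI)
    fix u v assume uv: "gap_ends K u v"
    then have "u < v" and mem: "u \<in> K" "v \<in> K" by (auto simp: gap_ends_def)
    obtain n where n: "G n = {u<..<v}" using index[OF uv] by blast
    note bd = bridges_bounded[OF K G n \<open>u < v\<close>]
    have "left_bridge K G n \<subseteq> {a..u}" using bd(1,3) hull unfolding atLeastAtMost_def by blast
    then have "?L n \<le> u - a" using a(2)[OF mem(1)] by (rule measure_le_length)
    then show "\<exists>a\<in>K. \<tau> * (v - u) \<le> u - a" using bridges(1)[OF n \<open>u < v\<close>] a by force
    have "right_bridge K G n \<subseteq> {v..b}" using bd(2,4) hull unfolding atLeastAtMost_def by blast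
    then have "?R n \<le> b - v" using b(2)[OF mem(2)] by (rule measure_le_length)
    then show "\<exists>b\<in>K. \<tau> * (v - u) \<le> b - v" using bridges(2)[OF n \<open>u < v\<close>] b by force
  next
    fix u v u' v' assume uv: "gap_ends K u v" and uv': "gap_ends K u' v'" and le: "v \<le> u'"
    from uv uv' have lt: "u < v" "u' < v'" by (auto simp: gap_ends_def)
    obtain n m where n: "G n = {u<..<v}" and m: "G m = {u'<..<v'}" using index uv uv' by metis
    have "n \<noteq> m"
    proof
      assume "n = m"
      moreover obtain z where "z \<in> {u<..<v}" using dense[OF lt(1)] by auto
      ultimately have "z \<in> {u'<..<v'}" "z < v" using n m by auto
      then show False using le by simp
    qed
    have dec: "decseq (\<lambda>n. measure lborel (G n))" using G by (simp add: gap_enumeration_def)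
    show "\<tau> * min (v - u) (v' - u') \<le> u' - v"
    proof (cases "m < n")
      case True
      have "right_bridge K G n \<subseteq> {v..u'}"
        using bridges_bounded(2)[OF K G n lt(1)] bridges_bounded(6)[OF K G n lt(1) True m lt(2) le]
        unfolding atLeastAtMost_def by blast
      then have "?R n \<le> u' - v" using le by (rule measure_le_length)
      moreover have "v - u \<le> v' - u'" using decseqD[OF dec, of m n] True n m lt by simp
      ultimately show ?thesis using bridges(2)[OF n lt(1)] by (simp add: min_def)
    next
      case False
      then have "n < m" using \<open>n \<noteq> m\<close> by simp
      then have "left_bridge K G m \<subseteq> {v..u'}"
        using bridges_bounded(1)[OF K G m lt(2)] bridges_bounded(5)[OF K G m lt(2) _ n lt(1) le]
        unfolding atLeastAtMost_def by blast
      then have "?L m \<le> u' - v" using le by (rule measure_le_length)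
      moreover have "v' - u' \<le> v - u" using decseqD[OF dec, of n m] \<open>n < m\<close> n m lt by simp
      ultimately show ?thesis using bridges(1)[OF m lt(2)] by (simp add: min_def)
    qed
  qed
qed

section \<open>Logarithms of thick sets\<close>

text \<open>The bridge \<open>[v, r]\<close> lies to the right of the gap \<open>(u, v)\<close>, where \<open>ln\<close> is flatter. The loss is
  controlled by \<open>\<tau> v \<le> 2 u\<close>, which follows from \<open>\<tau> (v - u) \<le> u\<close>; the shortened bridge of length
  \<open>s = \<tau> (v - u) \<le> v\<close> costs another factor \<open>2\<close>. Together they replace \<open>\<tau>\<close> by \<open>\<tau>\<^sup>2 / 4\<close>.\<close>

lemma ln_right_bridge_bound:
  fixes u v r \<tau> :: real
  assumes "0 < u" "u < v" "0 < \<tau>" "\<tau> \<le> 1" "\<tau> * (v - u) \<le> u" "\<tau> * (v - u) \<le> r - v"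
  shows "\<tau>\<^sup>2 / 4 * (ln v - ln u) \<le> ln r - ln v"
proof -
  define s where "s = \<tau> * (v - u)"
  have s: "0 < s" "s \<le> v - u" "s \<le> u" "v + s \<le> r"
    using assms by (auto simp: s_def mult_left_le_one_le)
  have "ln v - ln u = ln (v / u)" using assms by (simp add: ln_div)
  also have "\<dots> \<le> v / u - 1" using assms by (intro ln_le_minus_one) simp
  also have "\<dots> = (v - u) / u" using assms by (simp add: field_simps)
  finally have 1: "\<tau>\<^sup>2 / 4 * (ln v - ln u) \<le> \<tau>\<^sup>2 / 4 * ((v - u) / u)"
    using assms by (intro mult_left_mono) auto
  have "\<tau> * (2 * v) \<le> 4 * u"
  proof -
    have "\<tau> * u \<le> u" using assms by (simp add: mult_left_le_one_le)
    then show ?thesis using s(3) by (simp add: s_def algebra_simps)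
  qed
  then have "\<tau> * (2 * v) * s \<le> 4 * u * s" using s by (intro mult_right_mono) auto
  then have 2: "\<tau>\<^sup>2 / 4 * ((v - u) / u) \<le> s / (2 * v)"
    using assms by (simp add: s_def field_simps power2_eq_square)
  have 3: "s / (2 * v) \<le> s / (v + s)" using s assms by (intro divide_left_mono) auto
  have "ln (v / (v + s)) \<le> v / (v + s) - 1" using s assms by (intro ln_le_minus_one) simp
  also have "\<dots> = - (s / (v + s))" using s assms by (simp add: field_simps)
  finally have 4: "s / (v + s) \<le> ln (v + s) - ln v" using s assms by (simp add: ln_div)
  have "ln (v + s) \<le> ln r" using s assms by simp
  then show ?thesis using 1 2 3 4 by linarith
qed

text \<open>To the left of the gap \<open>ln\<close> is steeper, so the constant survives.\<close>

lemma ln_left_bridge_bound: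
  fixes l u v \<tau> :: real
  assumes "0 < l" "0 < u" "u < v" "0 \<le> \<tau>" "\<tau> * (v - u) \<le> u - l"
  shows "\<tau> * (ln v - ln u) \<le> ln u - ln l"
proof -
  have "ln (v / u) \<le> v / u - 1" using assms by (intro ln_le_minus_one) simp
  then have "\<tau> * (ln v - ln u) \<le> \<tau> * ((v - u) / u)"
    using assms by (intro mult_left_mono) (simp_all add: ln_div diff_divide_distrib)
  also have "\<dots> \<le> (u - l) / u" using assms by (simp add: divide_right_mono)
  also have "\<dots> = - (l / u - 1)" using assms by (simp add: field_simps)
  also have "\<dots> \<le> - ln (l / u)" using ln_le_minus_one[of "l / u"] assms by simp
  also have "\<dots> = ln u - ln l" using assms by (simp add: ln_div)
  finally show ?thesis .
qed

lemma gap_ends_ln: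
  assumes pos: "\<And>x. x \<in> A \<Longrightarrow> 0 < x" and "gap_ends (ln ` A) s t"
  obtains u v where "gap_ends A u v" "s = ln u" "t = ln v"
proof -
  from assms(2) obtain u v where uv: "u \<in> A" "v \<in> A" "s = ln u" "t = ln v" "ln u < ln v"
    and dj: "{s<..<t} \<inter> ln ` A = {}" by (auto simp: gap_ends_def)
  have "y \<notin> A" if "u < y" "y < v" for y
  proof
    assume "y \<in> A"
    then have "ln y \<in> {s<..<t} \<inter> ln ` A" using uv pos that by simp
    then show False using dj by blast
  qed
  then have "{u<..<v} \<inter> A = {}" by auto
  moreover have "u < v" using uv pos by simp
  ultimately show ?thesis using that[of u v] uv by (simp add: gap_ends_def)
qed

lemma thick_ln:
  assumes pos: "\<And>x. x \<in> A \<Longrightarrow> 0 < x" and thick: "thick \<tau> A" and \<tau>: "0 < \<tau>" "\<tau> \<le> 1"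
  shows "thick (\<tau>\<^sup>2 / 4) (ln ` A)"
proof -
  have small: "\<tau>\<^sup>2 / 4 \<le> \<tau>" using \<tau> mult_left_le_one_le[of \<tau> \<tau>] by (simp add: power2_eq_square)
  have left: "\<tau>\<^sup>2 / 4 * (ln v - ln u) \<le> ln u - ln l"
    if "0 < l" "0 < u" "u < v" "\<tau> * (v - u) \<le> u - l" for l u v
  proof -
    have "\<tau>\<^sup>2 / 4 * (ln v - ln u) \<le> \<tau> * (ln v - ln u)" using small that by (intro mult_right_mono) auto
    then show ?thesis using ln_left_bridge_bound[of l u v \<tau>] that \<tau> by linarith
  qed
  have gap: "0 < u" "u < v" "0 < v" "\<tau> * (v - u) \<le> u" if "gap_ends A u v" for u v
  proof -
    show "0 < u" "u < v" "0 < v" using that pos by (auto simp: gap_ends_def)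
    obtain a where "a \<in> A" "\<tau> * (v - u) \<le> u - a" using thick[unfolded thick_def, THEN conjunct1] \<open>gap_ends A u v\<close> by blast
    then show "\<tau> * (v - u) \<le> u" using pos[of a] by linarith
  qed
  show ?thesis
    unfolding thick_def
  proof (intro conjI allI impI)
    fix s t assume "gap_ends (ln ` A) s t"
    then obtain u v where uv: "gap_ends A u v" "s = ln u" "t = ln v" using gap_ends_ln[OF pos] by blast
    note g = gap[OF uv(1)]
    obtain a b where a: "a \<in> A" "\<tau> * (v - u) \<le> u - a" and b: "b \<in> A" "\<tau> * (v - u) \<le> b - v"
      using thick[unfolded thick_def, THEN conjunct1] uv(1) by blast
    show "\<exists>a\<in>ln ` A. \<tau>\<^sup>2 / 4 * (t - s) \<le> s - a"
      using left[OF pos[OF a(1)] g(1,2) a(2)] a(1) uv by blast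
    show "\<exists>b\<in>ln ` A. \<tau>\<^sup>2 / 4 * (t - s) \<le> b - t"
      using ln_right_bridge_bound[OF g(1,2) \<tau> g(4) b(2)] b(1) uv by blast
  next
    fix s t s' t' assume st: "gap_ends (ln ` A) s t" and st': "gap_ends (ln ` A) s' t'" and le: "t \<le> s'"
    obtain u v where uv: "gap_ends A u v" "s = ln u" "t = ln v" using gap_ends_ln[OF pos st] by blast
    obtain u' v' where uv': "gap_ends A u' v'" "s' = ln u'" "t' = ln v'" using gap_ends_ln[OF pos st'] by blast
    note g = gap[OF uv(1)] and g' = gap[OF uv'(1)]
    have "v \<le> u'" using le uv uv' g g' by simp
    then have d: "\<tau> * min (v - u) (v' - u') \<le> u' - v"
      using thick[unfolded thick_def, THEN conjunct2] uv(1) uv'(1) by blast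
    show "\<tau>\<^sup>2 / 4 * min (t - s) (t' - s') \<le> s' - t"
    proof (cases "v - u \<le> v' - u'")
      case True
      have "\<tau>\<^sup>2 / 4 * min (t - s) (t' - s') \<le> \<tau>\<^sup>2 / 4 * (t - s)" by (intro mult_left_mono) auto
      moreover have "\<tau>\<^sup>2 / 4 * (t - s) \<le> s' - t"
        using ln_right_bridge_bound[OF g(1,2) \<tau> g(4), of u'] d True uv uv' by (simp add: min_def)
      ultimately show ?thesis by linarith
    next
      case False
      have "\<tau>\<^sup>2 / 4 * min (t - s) (t' - s') \<le> \<tau>\<^sup>2 / 4 * (t' - s')" by (intro mult_left_mono) auto
      moreover have "\<tau>\<^sup>2 / 4 * (t' - s') \<le> s' - t"
        using left[OF g(3) g'(1,2)] d False uv uv' by (simp add: min_def)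
      ultimately show ?thesis by linarith
    qed
  qed
qed

section \<open>Splitting bridges at the largest gap\<close>

text \<open>A piece of \<open>A\<close> spanned by two of its points, in which every gap respects the ends with
  constant \<open>\<tau>\<close>. This is all of the hull's thickness that splitting at a gap has to preserve.\<close>

definition bridge :: "real \<Rightarrow> real set \<Rightarrow> real \<Rightarrow> real \<Rightarrow> bool" where
  "bridge \<tau> A p q \<longleftrightarrow> p \<in> A \<and> q \<in> A \<and> p \<le> q \<and>
     (\<forall>u v. gap_ends A u v \<longrightarrow> p \<le> u \<longrightarrow> v \<le> q \<longrightarrow> \<tau> * (v - u) \<le> u - p \<and> \<tau> * (v - u) \<le> q - v)"

lemma bridgeD:
  "bridge \<tau> A p q \<Longrightarrow> gap_ends A u v \<Longrightarrow> p \<le> u \<Longrightarrow> v \<le> q \<Longrightarrow>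
     \<tau> * (v - u) \<le> u - p \<and> \<tau> * (v - u) \<le> q - v"
  by (simp add: bridge_def)

lemma thick_gap_distance:
  "thick \<tau> A \<Longrightarrow> gap_ends A u v \<Longrightarrow> gap_ends A u' v' \<Longrightarrow> v \<le> u' \<Longrightarrow>
     \<tau> * min (v - u) (v' - u') \<le> u' - v"
  unfolding thick_def by blast

lemma bridge_hull:
  assumes "thick \<tau> A" "p \<in> A" "q \<in> A" and bounds: "\<And>x. x \<in> A \<Longrightarrow> p \<le> x \<and> x \<le> q"
  shows "bridge \<tau> A p q"
proof -
  have "\<tau> * (v - u) \<le> u - p \<and> \<tau> * (v - u) \<le> q - v" if "gap_ends A u v" for u v
  proof -
    obtain a b where "a \<in> A" "\<tau> * (v - u) \<le> u - a" "b \<in> A" "\<tau> * (v - u) \<le> b - v"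
      using assms(1)[unfolded thick_def, THEN conjunct1] \<open>gap_ends A u v\<close> by blast
    then show ?thesis using bounds[of a] bounds[of b] by linarith
  qed
  then show ?thesis using assms bounds by (simp add: bridge_def)
qed

text \<open>At the new end \<open>u\<close>, the distance to a gap of \<open>[p, u]\<close> is the distance between two gaps of \<open>A\<close>,
  where the minimum in \<open>thick\<close> is attained by the shorter one. This is why the gap at which a
  bridge is split must be the largest.\<close>

lemma bridge_split:
  assumes thick: "thick \<tau> A" and pq: "bridge \<tau> A p q"
    and uv: "gap_ends A u v" "p \<le> u" "v \<le> q"
    and largest: "\<And>u' v'. gap_ends A u' v' \<Longrightarrow> p \<le> u' \<Longrightarrow> v' \<le> q \<Longrightarrow> v' - u' \<le> v - u"
  shows "bridge \<tau> A p u" "bridge \<tau> A v q"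
proof -
  have lt: "u < v" using uv by (simp add: gap_ends_def)
  have "\<tau> * (v' - u') \<le> u - v'" if g: "gap_ends A u' v'" "p \<le> u'" "v' \<le> u" for u' v'
    using thick_gap_distance[OF thick g(1) uv(1) g(3)] largest[OF g(1,2)] g(3) uv(3) lt
    by (simp add: min_def split: if_splits)
  then show "bridge \<tau> A p u"
    using pq uv lt unfolding bridge_def gap_ends_def by force
  have "\<tau> * (v' - u') \<le> u' - v" if g: "gap_ends A u' v'" "v \<le> u'" "v' \<le> q" for u' v'
    using thick_gap_distance[OF thick uv(1) g(1,2)] largest[OF g(1) _ g(3)] g(2) uv(2) lt
    by (auto simp: min_def split: if_splits)
  then show "bridge \<tau> A v q"
    using pq uv lt unfolding bridge_def gap_ends_def by force
qed

text \<open>Splitting a system of bridges at its largest gap, as an induction principle. It terminates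
  because every split removes a gap of length at least \<open>\<epsilon>\<close>, of which there are finitely many. It is
  applied once with a fixed threshold, to decompose the sum into finitely many intervals, and once
  with arbitrarily small ones, to approximate a given point of such an interval.\<close>

lemma bridges_induct [consumes 4, case_names small split]:
  fixes A :: "'i \<Rightarrow> real set"
  assumes I: "finite I" "\<forall>i\<in>I. compact (A i) \<and> thick \<tau> (A i)" and \<epsilon>: "0 < \<epsilon>"
    and pq: "\<forall>i\<in>I. bridge \<tau> (A i) (p i) (q i)"
    and small: "\<And>p q. (\<And>i. i \<in> I \<Longrightarrow> bridge \<tau> (A i) (p i) (q i)) \<Longrightarrow>
      (\<And>i u v. i \<in> I \<Longrightarrow> gap_ends (A i) u v \<Longrightarrow> p i \<le> u \<Longrightarrow> v \<le> q i \<Longrightarrow> v - u < \<epsilon>) \<Longrightarrow> P p q"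
    and split: "\<And>p q i u v. (\<And>i. i \<in> I \<Longrightarrow> bridge \<tau> (A i) (p i) (q i)) \<Longrightarrow>
      i \<in> I \<Longrightarrow> gap_ends (A i) u v \<Longrightarrow> p i \<le> u \<Longrightarrow> v \<le> q i \<Longrightarrow> \<epsilon> \<le> v - u \<Longrightarrow>
      (\<And>j u' v'. j \<in> I \<Longrightarrow> gap_ends (A j) u' v' \<Longrightarrow> p j \<le> u' \<Longrightarrow> v' \<le> q j \<Longrightarrow> v' - u' \<le> v - u) \<Longrightarrow>
      P p (q(i := u)) \<Longrightarrow> P (p(i := v)) q \<Longrightarrow> P p q"
  shows "P p q"
proof -
  define S where "S p q = {(i, u, v). i \<in> I \<and> gap_ends (A i) u v \<and> p i \<le> u \<and> v \<le> q i \<and> \<epsilon> \<le> v - u}"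
    for p q :: "'i \<Rightarrow> real"
  have fin: "finite (S p q)" for p q
  proof (rule finite_subset)
    show "S p q \<subseteq> (SIGMA i:I. {(u, v). gap_ends (A i) u v \<and> \<epsilon> \<le> v - u})" by (auto simp: S_def)
    show "finite (SIGMA i:I. {(u, v). gap_ends (A i) u v \<and> \<epsilon> \<le> v - u})"
      using I \<epsilon> finite_large_gaps by (intro finite_SigmaI) auto
  qed
  show ?thesis using pq
  proof (induction "card (S p q)" arbitrary: p q rule: less_induct)
    case less
    have br: "bridge \<tau> (A i) (p i) (q i)" if "i \<in> I" for i using less.prems that by blast
    show ?case
    proof (cases "S p q = {}")
      case True
      show ?thesis
      proof (rule small[OF br])
        show "v - u < \<epsilon>" if "i \<in> I" "gap_ends (A i) u v" "p i \<le> u" "v \<le> q i" for i u v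
          using True that by (fastforce simp: S_def)
      qed
    next
      case False
      define len where "len = (\<lambda>(i::'i, u::real, v). v - u)"
      have "finite (len ` S p q)" "len ` S p q \<noteq> {}" using fin False by auto
      from Max_in[OF this] obtain i u v where iuv: "(i, u, v) \<in> S p q" "v - u = Max (len ` S p q)"
        unfolding len_def by fastforce
      then have iu: "i \<in> I" "gap_ends (A i) u v" "p i \<le> u" "v \<le> q i" "\<epsilon> \<le> v - u"
        by (auto simp: S_def)
      have max: "v' - u' \<le> v - u"
        if j: "j \<in> I" "gap_ends (A j) u' v'" "p j \<le> u'" "v' \<le> q j" for j u' v'
      proof (cases "\<epsilon> \<le> v' - u'")
        case True
        then have "(j, u', v') \<in> S p q" using j by (simp add: S_def)
        then have "len (j, u', v') \<le> Max (len ` S p q)" using fin by (intro Max_ge) auto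
        then show ?thesis using iuv by (simp add: len_def)
      next
        case False
        then show ?thesis using iu by linarith
      qed
      have uv: "u < v" using iu by (simp add: gap_ends_def)
      have halves: "bridge \<tau> (A i) (p i) u" "bridge \<tau> (A i) v (q i)"
        using bridge_split[OF _ br[OF iu(1)] iu(2-4)] I(2) iu(1) max[OF iu(1)] by blast+
      have smaller: "card T < card (S p q)" if "T \<subseteq> S p q" "(i, u, v) \<notin> T" for T
        using that iuv(1) fin by (intro psubset_card_mono) auto
      show ?thesis
      proof (rule split[OF br iu max])
        show "P p (q(i := u))"
          using iu uv by (intro less.hyps smaller) (use halves br in \<open>auto simp: S_def split: if_splits\<close>)
        show "P (p(i := v)) q"
          using iu uv by (intro less.hyps smaller) (use halves br in \<open>auto simp: S_def split: if_splits\<close>)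
      qed
    qed
  qed
qed

section \<open>Sums of many thick sets\<close>

definition sumset :: "'i set \<Rightarrow> ('i \<Rightarrow> real set) \<Rightarrow> real set" where
  "sumset I B = {\<Sum>i\<in>I. x i | x. \<forall>i\<in>I. x i \<in> B i}"

lemma sumsetI: "(\<And>i. i \<in> I \<Longrightarrow> x i \<in> B i) \<Longrightarrow> (\<Sum>i\<in>I. x i) \<in> sumset I B"
  by (auto simp: sumset_def)

lemma sumset_insert:
  assumes "finite I" "i \<notin> I"
  shows "sumset (insert i I) B = {a + b | a b. a \<in> B i \<and> b \<in> sumset I B}"
proof (intro equalityI subsetI)
  fix s assume "s \<in> sumset (insert i I) B"
  then show "s \<in> {a + b | a b. a \<in> B i \<and> b \<in> sumset I B}"
    using assms by (auto simp: sumset_def)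
next
  fix s assume "s \<in> {a + b | a b. a \<in> B i \<and> b \<in> sumset I B}"
  then obtain a x where x: "s = a + (\<Sum>j\<in>I. x j)" "a \<in> B i" "\<forall>j\<in>I. x j \<in> B j"
    by (auto simp: sumset_def)
  have "(\<Sum>j\<in>I. (x(i := a)) j) = (\<Sum>j\<in>I. x j)" using assms by (intro sum.cong) auto
  then have "s = (\<Sum>j\<in>insert i I. (x(i := a)) j)" using assms x by simp
  then show "s \<in> sumset (insert i I) B" using x by (simp only:, intro sumsetI) auto
qed

lemma compact_sumset:
  assumes "finite I" "\<And>i. i \<in> I \<Longrightarrow> compact (B i)"
  shows "compact (sumset I B)"
  using assms
proof (induction I rule: finite_induct)
  case empty
  then show ?case by (simp add: sumset_def)
next
  case (insert i I)
  then show ?case using compact_sums[of "B i" "sumset I B"] by (simp add: sumset_insert)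
qed

lemma sumset_split_gap:
  fixes A :: "'i \<Rightarrow> real set"
  assumes i: "i \<in> I" and uv: "gap_ends (A i) u v" "p i \<le> u" "v \<le> q i"
  shows "sumset I (\<lambda>j. A j \<inter> {p j..q j}) =
    sumset I (\<lambda>j. A j \<inter> {p j..(q(i := u)) j}) \<union> sumset I (\<lambda>j. A j \<inter> {(p(i := v)) j..q j})"
    (is "?S = ?L \<union> ?R")
proof (intro equalityI subsetI)
  fix s assume "s \<in> ?S"
  then obtain x where x: "s = (\<Sum>j\<in>I. x j)" "\<And>j. j \<in> I \<Longrightarrow> x j \<in> A j \<inter> {p j..q j}"
    by (auto simp: sumset_def)
  have "x i \<le> u \<or> v \<le> x i" using x(2)[OF i] uv(1) by (force simp: gap_ends_def)
  then show "s \<in> ?L \<union> ?R"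
  proof
    assume "x i \<le> u"
    then have "s \<in> ?L" unfolding x(1) using x(2) by (intro sumsetI) auto
    then show ?thesis ..
  next
    assume "v \<le> x i"
    then have "s \<in> ?R" unfolding x(1) using x(2) by (intro sumsetI) auto
    then show ?thesis ..
  qed
next
  fix s assume s: "s \<in> ?L \<union> ?R"
  have "u < v" using uv by (simp add: gap_ends_def)
  then have "A j \<inter> {p j..(q(i := u)) j} \<subseteq> A j \<inter> {p j..q j}"
    "A j \<inter> {(p(i := v)) j..q j} \<subseteq> A j \<inter> {p j..q j}" for j using uv by auto
  with s show "s \<in> ?S" unfolding sumset_def by blast
qed

text \<open>Each bridge is at least \<open>\<tau>\<close> times as long as every gap in every bridge; this is preserved by
  splitting at the largest gap, because each half is at least \<open>\<tau>\<close> times as long as that gap.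
  The bound on \<open>card I\<close> makes the two halves of a split cover the whole interval.\<close>

lemma sumset_of_comparable_bridges_dense:
  fixes A :: "'i \<Rightarrow> real set"
  assumes I: "finite I" "\<forall>i\<in>I. compact (A i) \<and> thick \<tau> (A i)"
    and \<tau>: "0 < \<tau>" and many: "1 \<le> (real (card I) - 1) * \<tau>" and \<epsilon>: "0 < \<epsilon>"
    and bridges: "\<forall>i\<in>I. bridge \<tau> (A i) (p i) (q i)"
    and comparable: "\<And>i j u v. i \<in> I \<Longrightarrow> j \<in> I \<Longrightarrow> gap_ends (A i) u v \<Longrightarrow> p i \<le> u \<Longrightarrow> v \<le> q i \<Longrightarrow>
      \<tau> * (v - u) \<le> q j - p j"
    and t: "t \<in> {sum p I..sum q I}"
  shows "\<exists>s\<in>sumset I (\<lambda>j. A j \<inter> {p j..q j}). \<bar>t - s\<bar> \<le> real (card I) * \<epsilon>"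
  using I \<epsilon> bridges comparable t
proof (induction p q rule: bridges_induct)
  case (small p q)
  \<comment> \<open>divide \<open>t\<close> among the summands in proportion; if all intervals are points, \<open>c = 0\<close>\<close>
  define c where "c = (t - sum p I) / (sum q I - sum p I)"
  have c: "0 \<le> c" "c \<le> 1" using small(4) by (auto simp: c_def divide_le_eq_1)
  define x where "x j = p j + c * (q j - p j)" for j
  have "sum x I = sum p I + c * (sum q I - sum p I)"
    by (simp add: x_def sum.distrib sum_distrib_left[symmetric] sum_subtractf)
  also have "\<dots> = t" using small(4) by (auto simp: c_def)
  finally have xt: "sum x I = t" .
  have "\<exists>y. y \<in> A j \<inter> {p j..q j} \<and> \<bar>x j - y\<bar> \<le> \<epsilon>" if j: "j \<in> I" for j
  proof -
    have br: "p j \<in> A j" "q j \<in> A j" "p j \<le> q j" using small(1)[OF j] by (auto simp: bridge_def)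
    have xj: "p j \<le> x j" "x j \<le> q j"
      using c br(3) mult_left_le_one_le[of "q j - p j" c] by (auto simp: x_def)
    show ?thesis
    proof (cases "x j \<in> A j")
      case True
      then show ?thesis using xj \<epsilon> by (intro exI[of _ "x j"]) auto
    next
      case False
      obtain u v where uv: "gap_ends (A j) u v" "p j \<le> u" "u < x j" "x j < v" "v \<le> q j"
        using gap_ends_around[of "A j" "p j" "q j" "x j"] I(2) j br xj False by blast
      have "v - u < \<epsilon>" using small(2)[OF j uv(1,2,5)] .
      moreover have "u \<in> A j" using uv by (simp add: gap_ends_def)
      ultimately show ?thesis using uv by (intro exI[of _ u]) auto
    qed
  qed
  then obtain y where y: "\<And>j. j \<in> I \<Longrightarrow> y j \<in> A j \<inter> {p j..q j} \<and> \<bar>x j - y j\<bar> \<le> \<epsilon>" by metis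
  have "\<bar>t - sum y I\<bar> = \<bar>\<Sum>j\<in>I. x j - y j\<bar>" by (simp add: xt[symmetric] sum_subtractf)
  also have "\<dots> \<le> (\<Sum>j\<in>I. \<bar>x j - y j\<bar>)" by (rule sum_abs)
  also have "\<dots> \<le> real (card I) * \<epsilon>" using y by (intro sum_bounded_above) auto
  finally show ?case using y by (intro bexI[of _ "sum y I"] sumsetI) auto
next
  case (split p q i u v)
  note br = split(1) and i = split(2) and gap = split(3-5) and comp = split(10) and t = split(11)
  note largest = split(7)
  have uv: "u < v" using gap by (simp add: gap_ends_def)
  have b: "\<tau> * (v - u) \<le> u - p i" "\<tau> * (v - u) \<le> q i - v"
    using bridgeD[OF br[OF i] gap] by auto
  have len: "\<tau> * (v' - u') \<le> \<tau> * (v - u)"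
    if "j \<in> I" "gap_ends (A j) u' v'" "p j \<le> u'" "v' \<le> q j" for j u' v'
    using largest[OF that] \<tau> by (intro mult_left_mono) auto
  \<comment> \<open>the sums of the two systems of intervals after the split overlap\<close>
  have "v - u \<le> (real (card I) - 1) * (\<tau> * (v - u))"
    using mult_right_mono[OF many, of "v - u"] uv by simp
  also have "\<dots> = real (card (I - {i})) * (\<tau> * (v - u))"
    using I(1) i by (cases "card I") (auto simp: card_Diff_singleton)
  also have "\<dots> \<le> (\<Sum>j\<in>I - {i}. q j - p j)"
    using comp[OF i _ gap] by (intro sum_bounded_below) auto
  finally have overlap: "v + sum p (I - {i}) \<le> u + sum q (I - {i})" by (simp add: sum_subtractf)
  have sp: "sum p I = p i + sum p (I - {i})" and sq: "sum q I = q i + sum q (I - {i})"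
    using I(1) i by (simp_all add: sum.remove)
  have sq': "sum (q(i := u)) I = u + sum q (I - {i})" and sp': "sum (p(i := v)) I = v + sum p (I - {i})"
    using I(1) i by (simp_all add: sum.remove[of I i])
  show ?case
  proof (cases "t \<le> u + sum q (I - {i})")
    case True
    have "\<exists>s\<in>sumset I (\<lambda>j. A j \<inter> {p j..(q(i := u)) j}). \<bar>t - s\<bar> \<le> real (card I) * \<epsilon>"
    proof (rule split(8))
      show "t \<in> {sum p I..sum (q(i := u)) I}" using True t unfolding sq' by simp
      fix j j' u' v'
      assume j: "j \<in> I" "j' \<in> I" "gap_ends (A j) u' v'" "p j \<le> u'" "v' \<le> (q(i := u)) j"
      then have "v' \<le> q j" using uv gap by (auto split: if_splits)
      then show "\<tau> * (v' - u') \<le> (q(i := u)) j' - p j'"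
        using comp[OF j(1-4)] len[OF j(1,3,4)] b by auto
    qed
    then show ?thesis using sumset_split_gap[of i I A u v p q, OF i gap] by blast
  next
    case False
    have "\<exists>s\<in>sumset I (\<lambda>j. A j \<inter> {(p(i := v)) j..q j}). \<bar>t - s\<bar> \<le> real (card I) * \<epsilon>"
    proof (rule split(9))
      show "t \<in> {sum (p(i := v)) I..sum q I}" using False t overlap unfolding sp' by simp
      fix j j' u' v'
      assume j: "j \<in> I" "j' \<in> I" "gap_ends (A j) u' v'" "(p(i := v)) j \<le> u'" "v' \<le> q j"
      then have "p j \<le> u'" using uv gap by (auto split: if_splits)
      then show "\<tau> * (v' - u') \<le> q j' - (p(i := v)) j'"
        using comp[OF j(1-3) _ j(5)] len[OF j(1,3) _ j(5)] b by auto
    qed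
    then show ?thesis using sumset_split_gap[of i I A u v p q, OF i gap] by blast
  qed
qed

text \<open>The approximations converge to a point of the sumset by compactness.\<close>

lemma sumset_of_comparable_bridges:
  fixes A :: "'i \<Rightarrow> real set"
  assumes I: "finite I" "\<forall>i\<in>I. compact (A i) \<and> thick \<tau> (A i)"
    and \<tau>: "0 < \<tau>" and many: "1 \<le> (real (card I) - 1) * \<tau>"
    and bridges: "\<forall>i\<in>I. bridge \<tau> (A i) (p i) (q i)"
    and comparable: "\<And>i j u v. i \<in> I \<Longrightarrow> j \<in> I \<Longrightarrow> gap_ends (A i) u v \<Longrightarrow> p i \<le> u \<Longrightarrow> v \<le> q i \<Longrightarrow>
      \<tau> * (v - u) \<le> q j - p j"
  shows "sumset I (\<lambda>j. A j \<inter> {p j..q j}) = {sum p I..sum q I}" (is "?S = _")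
proof (intro equalityI subsetI)
  fix s assume "s \<in> ?S"
  then obtain x where "s = sum x I" "\<And>j. j \<in> I \<Longrightarrow> x j \<in> A j \<inter> {p j..q j}" by (auto simp: sumset_def)
  then show "s \<in> {sum p I..sum q I}" by (auto intro!: sum_mono)
next
  fix t assume t: "t \<in> {sum p I..sum q I}"
  have closed: "closed ?S"
    using I by (intro compact_imp_closed compact_sumset) auto
  have card: "0 < real (card I)" using many by (cases "card I = 0") (use \<tau> in auto)
  have "\<exists>s\<in>?S. dist s t < d" if "0 < d" for d
  proof -
    have "0 < d / (2 * real (card I))" using card \<open>0 < d\<close> by simp
    then have "\<exists>s\<in>?S. \<bar>t - s\<bar> \<le> real (card I) * (d / (2 * real (card I)))"
      using sumset_of_comparable_bridges_dense[OF I \<tau> many _ bridges _ t] comparable by blast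
    then obtain s where "s \<in> ?S" "\<bar>t - s\<bar> \<le> real (card I) * (d / (2 * real (card I)))" by blast
    moreover have "real (card I) * (d / (2 * real (card I))) = d / 2" using card by simp
    ultimately have "dist s t < d" using \<open>0 < d\<close> unfolding dist_real_def by linarith
    then show ?thesis using \<open>s \<in> ?S\<close> by blast
  qed
  then have "t \<in> closure ?S" by (simp add: closure_approachable)
  then show "t \<in> ?S" using closed by simp
qed

lemma finite_union_closed_intervals_Un:
  assumes "finite_union_closed_intervals S" "finite_union_closed_intervals T"
  shows "finite_union_closed_intervals (S \<union> T)"
proof -
  obtain F H where "finite F" "\<forall>J\<in>F. \<exists>a b. a < b \<and> J = {a..b}" "S = \<Union>F"
    "finite H" "\<forall>J\<in>H. \<exists>a b. a < b \<and> J = {a..b}" "T = \<Union>H"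
    using assms unfolding finite_union_closed_intervals_def by blast
  then show ?thesis unfolding finite_union_closed_intervals_def
    by (intro exI[of _ "F \<union> H"]) auto
qed

text \<open>Bridges of length at least \<open>\<tau> \<delta>\<close> become comparable once their gaps are shorter than \<open>\<delta>\<close>,
  and splitting at a gap of length at least \<open>\<delta>\<close> leaves halves of length at least \<open>\<tau> \<delta>\<close>.\<close>

lemma sumset_of_bridges:
  fixes A :: "'i \<Rightarrow> real set"
  assumes I: "finite I" "\<forall>i\<in>I. compact (A i) \<and> thick \<tau> (A i)"
    and \<delta>: "0 < \<delta>" and bridges: "\<forall>i\<in>I. bridge \<tau> (A i) (p i) (q i)"
    and \<tau>: "0 < \<tau>" and many: "1 \<le> (real (card I) - 1) * \<tau>"
    and long: "\<And>i. i \<in> I \<Longrightarrow> \<tau> * \<delta> \<le> q i - p i"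
  shows "finite_union_closed_intervals (sumset I (\<lambda>j. A j \<inter> {p j..q j}))"
  using I \<delta> bridges long
proof (induction p q rule: bridges_induct)
  case (small p q)
  have "\<tau> * (v - u) \<le> q j - p j"
    if "i \<in> I" "j \<in> I" "gap_ends (A i) u v" "p i \<le> u" "v \<le> q i" for i j u v
  proof -
    have "\<tau> * (v - u) \<le> \<tau> * \<delta>" using small(2)[OF that(1,3-5)] \<tau> by simp
    then show ?thesis using small(3)[OF that(2)] by linarith
  qed
  then have S: "sumset I (\<lambda>j. A j \<inter> {p j..q j}) = {sum p I..sum q I}"
    using small(1) by (intro sumset_of_comparable_bridges[OF I \<tau> many]) auto
  have "I \<noteq> {}" using many \<tau> by auto
  moreover have "p i < q i" if "i \<in> I" for i
    using small(3)[OF that] mult_pos_pos[OF \<tau> \<delta>] by linarith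
  ultimately have "sum p I < sum q I" using I(1) by (intro sum_strict_mono) auto
  then show ?case
    unfolding S finite_union_closed_intervals_def by (intro exI[of _ "{{sum p I..sum q I}}"]) auto
next
  case (split p q i u v)
  note i = split(2) and gap = split(3-5)
  have "\<tau> * \<delta> \<le> \<tau> * (v - u)" using split(6) \<tau> by simp
  then have len: "\<tau> * \<delta> \<le> u - p i" "\<tau> * \<delta> \<le> q i - v"
    using bridgeD[OF split(1)[OF i] gap] by auto
  have "finite_union_closed_intervals (sumset I (\<lambda>j. A j \<inter> {p j..(q(i := u)) j}))"
    by (rule split(8)) (use len split(10) in auto)
  moreover have "finite_union_closed_intervals (sumset I (\<lambda>j. A j \<inter> {(p(i := v)) j..q j}))"
    by (rule split(9)) (use len split(10) in auto)
  ultimately show ?case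
    unfolding sumset_split_gap[of i I A u v p q, OF i gap] by (rule finite_union_closed_intervals_Un)
qed

text \<open>The threshold \<open>\<delta>\<close> is the length of the shortest hull, so that the hulls themselves are long
  enough to start the splitting.\<close>

theorem sumset_of_thick_sets:
  fixes A :: "'i \<Rightarrow> real set"
  assumes I: "finite I" and A: "\<forall>i\<in>I. compact (A i) \<and> thick \<tau> (A i)"
    and two: "\<And>i. i \<in> I \<Longrightarrow> \<exists>x\<in>A i. \<exists>y\<in>A i. x < y"
    and \<tau>: "0 < \<tau>" "\<tau> \<le> 1" and many: "1 \<le> (real (card I) - 1) * \<tau>"
  shows "finite_union_closed_intervals (sumset I A)"
proof -
  have "\<exists>a b. a \<in> A i \<and> b \<in> A i \<and> a < b \<and> (\<forall>x\<in>A i. a \<le> x \<and> x \<le> b)" if i: "i \<in> I" for i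
  proof -
    obtain x y where xy: "x \<in> A i" "y \<in> A i" "x < y" using two[OF i] by blast
    obtain a b where "a \<in> A i" "\<forall>x\<in>A i. a \<le> x" "b \<in> A i" "\<forall>x\<in>A i. x \<le> b"
      using compact_attains_inf[of "A i"] compact_attains_sup[of "A i"] A i xy(1) by blast
    moreover from this have "a < b" using xy by fastforce
    ultimately show ?thesis by blast
  qed
  then obtain p q where pq: "\<And>i. i \<in> I \<Longrightarrow> p i \<in> A i \<and> q i \<in> A i \<and> p i < q i \<and> (\<forall>x\<in>A i. p i \<le> x \<and> x \<le> q i)"
    by metis
  have ne: "I \<noteq> {}" using many \<tau> by auto
  define \<delta> where "\<delta> = Min ((\<lambda>i. q i - p i) ` I)"
  have \<delta>: "0 < \<delta>" using pq I ne by (simp add: \<delta>_def)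
  have "\<tau> * \<delta> \<le> q i - p i" if "i \<in> I" for i
  proof -
    have "\<delta> \<le> q i - p i" unfolding \<delta>_def using I that by (intro Min_le) auto
    then show ?thesis using \<tau> \<delta> mult_left_le_one_le[of \<delta> \<tau>] by linarith
  qed
  moreover have "bridge \<tau> (A i) (p i) (q i)" if "i \<in> I" for i
    using pq[OF that] A that by (intro bridge_hull) auto
  ultimately have "finite_union_closed_intervals (sumset I (\<lambda>j. A j \<inter> {p j..q j}))"
    using sumset_of_bridges[OF I A \<delta>, of p q] \<tau>(1) many by blast
  moreover have "sumset I (\<lambda>j. A j \<inter> {p j..q j}) = sumset I A"
    unfolding sumset_def using pq by fastforce
  ultimately show ?thesis by simp
qed

section \<open>Products\<close>

lemma exp_image_Icc: "exp ` {a..b} = {exp a..exp (b::real)}"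
proof (intro equalityI subsetI)
  fix y assume y: "y \<in> {exp a..exp b}"
  then have "0 < y" using exp_gt_zero[of a] by (simp add: less_le_trans[of 0 "exp a"])
  then show "y \<in> exp ` {a..b}" using y using ln_ge_iff[of y a] ln_le_cancel_iff[of y "exp b"] by (intro image_eqI[of _ _ "ln y"]) auto
qed auto

lemma finite_union_closed_intervals_exp:
  assumes "finite_union_closed_intervals S"
  shows "finite_union_closed_intervals (exp ` S)"
proof -
  obtain F where F: "finite F" "\<forall>J\<in>F. \<exists>a b. a < b \<and> J = {a..b}" "S = \<Union>F"
    using assms unfolding finite_union_closed_intervals_def by blast
  have "\<exists>a b. a < b \<and> exp ` J = {a..b}" if "J \<in> F" for J
    using F(2) that exp_image_Icc exp_less_mono by metis
  then show ?thesis using F unfolding finite_union_closed_intervals_def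
    by (intro exI[of _ "(`) exp ` F"]) auto
qed

lemma exp_sumset_ln:
  fixes K :: "'i \<Rightarrow> real set"
  assumes I: "finite I" and pos: "\<And>i x. i \<in> I \<Longrightarrow> x \<in> K i \<Longrightarrow> 0 < x"
  shows "exp ` sumset I (\<lambda>i. ln ` K i) = {\<Prod>i\<in>I. x i | x. \<forall>i\<in>I. x i \<in> K i}"
proof (intro equalityI subsetI)
  fix s assume "s \<in> exp ` sumset I (\<lambda>i. ln ` K i)"
  then obtain y where y: "s = exp (\<Sum>i\<in>I. y i)" "\<forall>i\<in>I. y i \<in> ln ` K i" by (auto simp: sumset_def)
  then have "\<forall>i\<in>I. exp (y i) \<in> K i" using pos by force
  moreover have "s = (\<Prod>i\<in>I. exp (y i))" using y I by (simp add: exp_sum)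
  ultimately show "s \<in> {\<Prod>i\<in>I. x i | x. \<forall>i\<in>I. x i \<in> K i}" by auto
next
  fix s assume "s \<in> {\<Prod>i\<in>I. x i | x. \<forall>i\<in>I. x i \<in> K i}"
  then obtain x where x: "s = (\<Prod>i\<in>I. x i)" "\<forall>i\<in>I. x i \<in> K i" by auto
  have "s = (\<Prod>i\<in>I. exp (ln (x i)))" using x pos by simp
  also have "\<dots> = exp (\<Sum>i\<in>I. ln (x i))" using I by (simp add: exp_sum)
  finally show "s \<in> exp ` sumset I (\<lambda>i. ln ` K i)" using x by (auto intro!: imageI sumsetI)
qed

lemma cantor_set_two_points:
  assumes "cantor_set K"
  shows "\<exists>x\<in>K. \<exists>y\<in>K. x < y"
proof -
  obtain x where "x \<in> K" "x islimpt K"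
    using assms by (auto simp: cantor_set_def isolated_in_islimpt_iff)
  then obtain y where "y \<in> K" "y \<noteq> x" by (auto simp: islimpt_def)
  then show ?thesis using \<open>x \<in> K\<close> by (metis linorder_neqE)
qed

theorem corollary1p18:
  fixes K :: "nat \<Rightarrow> real set"
  assumes "\<And>i. cantor_set (K i)"
    and "\<And>i j. i \<noteq> j \<Longrightarrow> convex hull (K i) \<noteq> convex hull (K j)"
    and "(INF i. ereal (thickness (K i))) > 0"
    and "(INF i. ereal (LEAST x. x \<in> K i)) > 0"
  shows "\<exists>k\<ge>1. \<exists>\<iota>::nat \<Rightarrow> nat. inj_on (\<lambda>j. K (\<iota> j)) {1..k} \<and>
           finite_union_closed_intervals
             {\<Prod>j=1..k. x j | x. \<forall>j\<in>{1..k}. x j \<in> K (\<iota> j)}"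
proof -
  have pos: "0 < x" if "x \<in> K i" for i x
  proof -
    obtain a where a: "a \<in> K i" "\<And>y. y \<in> K i \<Longrightarrow> a \<le> y"
      using assms(1)[of i] compact_attains_inf by (metis cantor_set_def)
    then have "(LEAST x. x \<in> K i) = a" by (intro Least_equality)
    then have "0 < ereal a" using less_le_trans[OF assms(4) INF_lower[of i UNIV]] by simp
    then show ?thesis using a(2)[OF that] by simp
  qed
  obtain t where t: "0 < ereal t" "ereal t < (INF i. ereal (thickness (K i)))"
    using ereal_dense2[OF assms(3)] by auto
  define \<tau> where "\<tau> = min t 1"
  have \<tau>: "0 < \<tau>" "\<tau> \<le> 1" using t by (auto simp: \<tau>_def)
  have thick: "thick \<tau> (K i)" for i
  proof -
    have "ereal t < ereal (thickness (K i))" using t(2) INF_lower[of i UNIV] by (rule less_le_trans) simp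
    then show ?thesis using assms(1) by (intro thick_of_thickness) (auto simp: \<tau>_def)
  qed
  \<comment> \<open>the constant that survives the logarithm\<close>
  define \<sigma> where "\<sigma> = \<tau>\<^sup>2 / 4"
  have \<sigma>: "0 < \<sigma>" "\<sigma> \<le> 1" using \<tau> power_le_one[of \<tau> 2] by (auto simp: \<sigma>_def)
  define k where "k = Suc (nat \<lceil>1 / \<sigma>\<rceil>)"
  have "1 / \<sigma> \<le> real k - 1" by (simp add: k_def real_nat_ceiling_ge)
  then have many: "1 \<le> (real (card {1..k}) - 1) * \<sigma>" using \<sigma> by (simp add: pos_divide_le_eq)
  have cpt: "compact (ln ` K i)" for i
  proof (rule compact_continuous_image)
    show "continuous_on (K i) ln" using pos by (intro continuous_on_ln continuous_on_id) force
    show "compact (K i)" using assms(1) by (simp add: cantor_set_def)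
  qed
  have two: "\<exists>x\<in>ln ` K i. \<exists>y\<in>ln ` K i. x < y" for i
    using cantor_set_two_points[OF assms(1)[of i]] pos by force
  have "thick \<sigma> (ln ` K i)" for i
    unfolding \<sigma>_def using pos by (intro thick_ln thick \<tau>)
  then have "finite_union_closed_intervals (sumset {1..k} (\<lambda>i. ln ` K i))"
    using cpt two \<sigma> many by (intro sumset_of_thick_sets[of _ _ \<sigma>]) auto
  then have "finite_union_closed_intervals {\<Prod>j=1..k. x j | x. \<forall>j\<in>{1..k}. x j \<in> K j}"
    using finite_union_closed_intervals_exp exp_sumset_ln[of "{1..k}" K] pos by fastforce
  moreover have "inj_on K {1..k}" using assms(2) by (metis inj_onI)
  moreover have "1 \<le> k" by (simp add: k_def)
  ultimately show ?thesis by (intro exI[of _ k] conjI exI[of _ id]) auto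
qed

end
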